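(* Whenever all the series concerned are either convergent or terminating, $$\sum_{m,n=0}^\infty\frac{(3/2,m+n)(2,m+n)(-1)^m 2^{-2-2m-2n}x^{m+n}}{(m+n)!\,(3/2,m)(3/2,n)\,m!\,n!}H_{2m+1}(iy^{1/2})\,H_{2n+1}(y^{1/2})=iy\,\exp(4xy).$$
   Context: Here $x,y$ are complex variables and $i^2=-1$. $(\alpha,n)=\alpha(\alpha+1)\cdots(\alpha+n-1)$ for $n\ge1$ and $(\alpha,0)=1$ (Pochhammer symbol). $H_n$ is the Hermite polynomial in the standard normalization $\sum_{n\ge0}H_n(z)t^n/n!=e^{2zt-t^2}$. *)

theory Defs
  imports "HOL-Complex_Analysis.Complex_Analysis"
begin

text \<open>\<open>H\<^sub>n(z)\<close> is \<open>n!\<close> times the \<open>n\<close>-th Taylor coefficient at \<open>t = 0\<close> of the generating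
  function \<open>exp (2zt - t\<^sup>2)\<close>.\<close>

definition hermite :: "nat \<Rightarrow> complex \<Rightarrow> complex" where
  "hermite n z = (deriv ^^ n) (\<lambda>t. exp (2 * z * t - t\<^sup>2)) 0"

lemma hermite_generating_function:
  "(\<lambda>n. hermite n z * t ^ n / fact n) sums exp (2 * z * t - t\<^sup>2)"
proof -
  have "(\<lambda>t. exp (2 * z * t - t\<^sup>2)) holomorphic_on ball 0 (norm t + 1)"
    by (intro holomorphic_intros)
  from holomorphic_power_series[OF this, of t] show ?thesis
    by (simp add: hermite_def field_simps)
qed

definition hermite_double_term :: "complex \<Rightarrow> complex \<Rightarrow> nat \<Rightarrow> nat \<Rightarrow> complex" where
  "hermite_double_term x y m n =
     (pochhammer (3/2) (m + n) * pochhammer 2 (m + n) * (-1) ^ m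
        * 2 powi (- 2 - 2 * int m - 2 * int n) * x ^ (m + n))
     / (fact (m + n) * pochhammer (3/2) m * pochhammer (3/2) n * fact m * fact n)
     * hermite (2 * m + 1) (\<i> * csqrt y) * hermite (2 * n + 1) (csqrt y)"

end

(* Substituting i t for t in the generating function of H_n(i w) turns exp (-t^2) into exp (t^2).
   Hence the odd parts sinh (2 w t) exp (-t^2) and -sinh (2 w t) exp (t^2) of the generating
   functions of H_n(w) and H_n(i w) multiply to -sinh (2 w t)^2, in which the Gaussian factors
   have cancelled. Comparing the coefficients of t^(2N+2) evaluates the sum over each diagonal
   m + n = N as i y (4 x y)^N / N!. *)
theory Submission
  imports Defs
begin

text \<open>Used as \<open>4^m * m! * (3/2)_m = (2m+1)!\<close>: the denominators and powers of 2 in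
  the summand merge into the factorials that normalize odd Taylor coefficients.\<close>

lemma pochhammer_three_halves:
  "pochhammer (3/2 :: 'a :: field_char_0) n = fact (2 * n + 1) / (4 ^ n * fact n)"
proof (induction n)
  case (Suc n)
  have nz: "of_nat n + 1 \<noteq> (0 :: 'a)"
    by (metis of_nat_Suc of_nat_eq_0_iff add.commute nat.distinct(2))
  have "fact (2 * Suc n + 1) = (4 * (3/2 + of_nat n) * (of_nat n + 1) * fact (2 * n + 1) :: 'a)"
    by (simp add: algebra_simps)
  moreover have "fact (Suc n) = ((of_nat n + 1) * fact n :: 'a)"
    by (simp add: algebra_simps)
  ultimately show ?case
    using nz by (simp only: pochhammer_Suc Suc.IH) (simp del: fact_Suc, simp add: field_simps del: fact_Suc)
qed simp

lemma pochhammer_two: "pochhammer (2 :: 'a :: field_char_0) n = fact (n + 1)"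
  by (induction n) (simp_all add: pochhammer_Suc algebra_simps)

text \<open>Half the difference of the generating functions at t and -t. Even terms stay as zeros,
  so this is a full power series, ready for a Cauchy product.\<close>

lemma hermite_odd_generating_function:
  "(\<lambda>n. (if odd n then hermite n z / fact n else 0) * t ^ n) sums
     (exp (2 * z * t - t\<^sup>2) / 2 - exp (- (2 * z * t) - t\<^sup>2) / 2)"
proof -
  have "(\<lambda>n. hermite n z * t ^ n / fact n / 2 - hermite n z * (-t) ^ n / fact n / 2) sums
          (exp (2 * z * t - t\<^sup>2) / 2 - exp (2 * z * (-t) - (-t)\<^sup>2) / 2)"
    by (intro sums_diff sums_divide hermite_generating_function)
  moreover have "hermite n z * t ^ n / fact n / 2 - hermite n z * (-t) ^ n / fact n / 2 =
      (if odd n then hermite n z / fact n else 0) * t ^ n" for n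
    by auto
  ultimately show ?thesis by simp
qed

text \<open>The odd indices up to 2N+2 are exactly 2m+1 with m \<le> N, and since 2N+2 is even, the
  complementary index is then odd as well.\<close>

lemma sum_odd_antidiagonal:
  fixes f :: "nat \<Rightarrow> nat \<Rightarrow> 'a :: comm_monoid_add"
  assumes "\<And>i j. even i \<Longrightarrow> f i j = 0"
  shows "(\<Sum>i=0..2*N+2. f i (2*N+2-i)) = (\<Sum>m\<le>N. f (2*m+1) (2*(N-m)+1))"
proof -
  have "(\<Sum>i=0..2*N+2. f i (2*N+2-i)) = (\<Sum>i\<in>(\<lambda>m. 2*m+1) ` {..N}. f i (2*N+2-i))"
  proof (rule sum.mono_neutral_right)
    show "\<forall>i\<in>{0..2*N+2} - (\<lambda>m. 2*m+1) ` {..N}. f i (2*N+2-i) = 0"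
      using assms by (force elim!: oddE)
  qed auto
  also have "\<dots> = (\<Sum>m\<le>N. f (2*m+1) (2*N+2-(2*m+1)))"
    by (subst sum.reindex) (auto simp: inj_on_def)
  also have "\<dots> = (\<Sum>m\<le>N. f (2*m+1) (2*(N-m)+1))"
    by (intro sum.cong refl arg_cong2[of _ _ _ _ f]) auto
  finally show ?thesis .
qed

lemma hermite_odd_convolution:
  "(\<Sum>m\<le>N. (-1) ^ m * (hermite (2*m+1) (\<i> * w) / fact (2*m+1)) *
             (hermite (2*(N-m)+1) w / fact (2*(N-m)+1))) =
     \<i> * (4 * w) ^ (2*N+2) / (2 * fact (2*N+2))"
proof -
  \<comment> \<open>The factor \<open>\<i> ^ n\<close> encodes the substitution of
    \<open>\<i> * t\<close> for t; at n = 2m+1 it equals \<open>\<i> * (-1) ^ m\<close>, the source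
    of the alternating sign.\<close>
  define a where "a n = (if odd n then hermite n (\<i> * w) / fact n else 0) * \<i> ^ n" for n
  define b where "b n = (if odd n then hermite n w / fact n else 0)" for n
  define A where "A t = exp (-(2 * w * t) + t\<^sup>2) / 2 - exp (2 * w * t + t\<^sup>2) / 2" for t
  define B where "B t = exp (2 * w * t - t\<^sup>2) / 2 - exp (- (2 * w * t) - t\<^sup>2) / 2" for t
  have "(\<lambda>n. a n * t ^ n) sums A t" for t
    using hermite_odd_generating_function[of "\<i> * w" "\<i> * t"]
    by (simp add: a_def A_def power_mult_distrib mult_ac)
  then have A: "A has_fps_expansion Abs_fps a"
    by (intro has_fps_expansionI) auto
  have "(\<lambda>n. b n * t ^ n) sums B t" for t
    using hermite_odd_generating_function[of w t] by (simp add: b_def B_def)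
  then have B: "B has_fps_expansion Abs_fps b"
    by (intro has_fps_expansionI) auto
  have "A t * B t = 1/2 - (exp (4 * w * t) + exp (-(4 * w) * t)) / 4" for t
  proof -
    have "A t * B t = - ((exp (2 * w * t) - exp (-(2 * w * t)))\<^sup>2 / 4) * (exp (t\<^sup>2) * exp (-(t\<^sup>2)))"
      unfolding A_def B_def diff_conv_add_uminus exp_add by (simp add: power2_eq_square field_simps)
    also have "exp (t\<^sup>2) * exp (-(t\<^sup>2)) = 1"
      by (simp flip: exp_add)
    also have "(exp (2 * w * t) - exp (-(2 * w * t)))\<^sup>2 = exp (4 * w * t) + exp (-(4 * w) * t) - 2"
      by (simp add: power2_eq_square algebra_simps flip: exp_add)
    finally show ?thesis by (simp add: field_simps)
  qed
  then have eq: "(\<lambda>t. A t * B t) = (\<lambda>t. 1/2 - (exp (4 * w * t) + exp (-(4 * w) * t)) * (1/4))"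
    by (simp add: fun_eq_iff)
  have "(\<lambda>t. A t * B t) has_fps_expansion
          fps_const (1/2) - (fps_exp (4 * w) + fps_exp (-(4 * w))) * fps_const (1/4)"
    unfolding eq by (intro fps_expansion_intros)
  then have "Abs_fps a * Abs_fps b =
          fps_const (1/2) - (fps_exp (4 * w) + fps_exp (-(4 * w))) * fps_const (1/4)"
    using has_fps_expansion_mult[OF A B] by (rule fps_expansion_unique_complex[rotated])
  \<comment> \<open>The index is positive, so the constant 1/2 contributes nothing; it is even, so
    both exponentials contribute equally, and 2/4 = 1/2.\<close>
  then have "fps_nth (Abs_fps a * Abs_fps b) (2*N+2) = - ((4 * w) ^ (2*N+2) / (2 * fact (2*N+2)))"
    by (simp del: fact_Suc power_Suc)
  moreover have "fps_nth (Abs_fps a * Abs_fps b) (2*N+2) = (\<Sum>m\<le>N. a (2*m+1) * b (2*(N-m)+1))"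
    unfolding fps_mult_nth fps_nth_Abs_fps by (rule sum_odd_antidiagonal) (simp add: a_def)
  moreover have "a (2*m+1) * b (2*(N-m)+1) =
      \<i> * ((-1) ^ m * (hermite (2*m+1) (\<i> * w) / fact (2*m+1)) *
             (hermite (2*(N-m)+1) w / fact (2*(N-m)+1)))" for m
    by (simp add: a_def b_def power_mult del: fact_Suc)
  ultimately have "\<i> * (\<Sum>m\<le>N. (-1) ^ m * (hermite (2*m+1) (\<i> * w) / fact (2*m+1)) *
             (hermite (2*(N-m)+1) w / fact (2*(N-m)+1))) =
        - ((4 * w) ^ (2*N+2) / (2 * fact (2*N+2)))"
    by (simp add: sum_distrib_left del: fact_Suc power_Suc)
  \<comment> \<open>A second factor \<i> turns the first into -1, which cancels the sign on the
    right.\<close>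
  then have "\<i> * (\<i> * (\<Sum>m\<le>N. (-1) ^ m * (hermite (2*m+1) (\<i> * w) / fact (2*m+1)) *
             (hermite (2*(N-m)+1) w / fact (2*(N-m)+1)))) =
        \<i> * (- ((4 * w) ^ (2*N+2) / (2 * fact (2*N+2))))"
    by (rule arg_cong)
  then show ?thesis
    by (simp del: fact_Suc power_Suc flip: mult.assoc)
qed

text \<open>Splits off a factor depending only on m + n, constant on each diagonal; what remains is
  the summand of \<open>hermite_odd_convolution\<close>.\<close>

lemma hermite_double_term_altdef:
  "hermite_double_term x y m n =
     pochhammer (3/2) (m + n) * pochhammer 2 (m + n) * x ^ (m + n) / (4 * fact (m + n)) *
     ((-1) ^ m * (hermite (2*m+1) (\<i> * csqrt y) / fact (2*m+1)) *
       (hermite (2*n+1) (csqrt y) / fact (2*n+1)))"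
proof -
  have "- 2 - 2 * int m - 2 * int n = - int (2 * (m + n + 1))"
    by simp
  then have "(2 :: complex) powi (- 2 - 2 * int m - 2 * int n) = inverse (2 ^ (2 * (m + n + 1)))"
    by (simp only: power_int_minus power_int_of_nat)
  also have "\<dots> = 1 / (4 * 4 ^ m * 4 ^ n)"
    unfolding power_mult by (simp add: power_add field_simps)
  finally show ?thesis
    unfolding hermite_double_term_def pochhammer_three_halves[of m] pochhammer_three_halves[of n]
    by (simp add: field_simps del: fact_Suc)
qed

lemma hermite_double_term_diagonal_sum:
  "(\<Sum>m\<le>N. hermite_double_term x y m (N - m)) = \<i> * y * ((4 * x * y) ^ N / fact N)"
proof -
  have "(\<Sum>m\<le>N. hermite_double_term x y m (N - m)) =
      pochhammer (3/2) N * pochhammer 2 N * x ^ N / (4 * fact N) *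
      (\<i> * (4 * csqrt y) ^ (2*N+2) / (2 * fact (2*N+2)))"
    unfolding hermite_odd_convolution[symmetric] sum_distrib_left
    by (intro sum.cong refl) (simp add: hermite_double_term_altdef)
  \<comment> \<open>Only an even power of the root occurs, so the result is a polynomial in y,
    independent of the branch of \<open>csqrt\<close>.\<close>
  also have "(4 * csqrt y) ^ (2*N+2) = ((4 * csqrt y)\<^sup>2) ^ (N+1)"
    by (simp only: power_mult [symmetric]) simp
  also have "((4 * csqrt y)\<^sup>2) ^ (N+1) = 16 * y * (16 * y) ^ N"
    by (simp add: power_mult_distrib)
  also have "fact (2*N+2) = (2 * (of_nat N + 1) * fact (2*N+1) :: complex)"
    by (simp add: algebra_simps)
  also have "pochhammer 2 N = ((of_nat N + 1) * fact N :: complex)"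
    by (simp add: pochhammer_two algebra_simps)
  \<comment> \<open>The factors N+1 and (2N+1)! cancel, and the \<open>4 ^ N\<close> in the
    denominator of \<open>pochhammer (3/2) N\<close> reduces \<open>16 ^ N\<close> to
    \<open>4 ^ N\<close>.\<close>
  also have "pochhammer (3/2) N * ((of_nat N + 1) * fact N) * x ^ N / (4 * fact N) *
      (\<i> * (16 * y * (16 * y) ^ N) / (2 * (2 * (of_nat N + 1) * fact (2*N+1)))) =
      \<i> * y * ((4 * x * y) ^ N / fact N)"
  proof -
    have "of_nat N + 1 \<noteq> (0 :: complex)"
      by (metis of_nat_Suc of_nat_eq_0_iff add.commute nat.distinct(2))
    moreover from this have "2 * of_nat N + 2 \<noteq> (0 :: complex)"
      by (metis distrib_left mult.right_neutral mult_eq_0_iff zero_neq_numeral)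
    moreover have "(16 :: complex) ^ N = 4 ^ N * 4 ^ N"
      by (simp flip: power_mult_distrib)
    ultimately show ?thesis
      by (simp add: pochhammer_three_halves power_mult_distrib divide_simps del: fact_Suc)
  qed
  finally show ?thesis .
qed

text \<open>Summability over pairs is unconditional, so the series may be regrouped by diagonals,
  whose sums form an exponential series. A terminating series has finitely many nonzero terms and is
  thus summable.\<close>

theorem mainTheorem8:
  fixes x y :: complex
  assumes "(\<lambda>(m, n). hermite_double_term x y m n) summable_on (UNIV :: (nat \<times> nat) set)"
  shows "((\<lambda>(m, n). hermite_double_term x y m n) has_sum (\<i> * y * exp (4 * x * y)))
           (UNIV :: (nat \<times> nat) set)"
proof -
  from assms obtain S
    where S: "((\<lambda>(m, n). hermite_double_term x y m n) has_sum S) (UNIV :: (nat \<times> nat) set)"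
    by (auto simp: summable_on_def)
  also have "?this \<longleftrightarrow>
      ((\<lambda>(N, m). hermite_double_term x y m (N - m)) has_sum S) (SIGMA N:UNIV. {..N})"
    \<comment> \<open>The pair (m, n) is recorded by its diagonal N = m + n and its position m; as m
      \<le> N, the natural subtraction N - m is exact.\<close>
    by (rule has_sum_reindex_bij_witness[of _ "\<lambda>(N, m). (m, N - m)" "\<lambda>(m, n). (m + n, m)"]) auto
  \<comment> \<open>Summing first over each finite diagonal preserves the total S.\<close>
  finally have "((\<lambda>N. \<i> * y * ((4 * x * y) ^ N / fact N)) has_sum S) UNIV"
  proof (rule has_sum_SigmaD)
    fix N :: nat
    show "((\<lambda>m. case (N, m) of (N, m) \<Rightarrow> hermite_double_term x y m (N - m)) has_sum
            \<i> * y * ((4 * x * y) ^ N / fact N)) {..N}"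
      using has_sum_finite[of "{..N}" "\<lambda>m. hermite_double_term x y m (N - m)"]
      by (simp add: hermite_double_term_diagonal_sum)
  qed
  then have "(\<lambda>N. \<i> * y * ((4 * x * y) ^ N / fact N)) sums S"
    by (rule has_sum_imp_sums)
  moreover have "(\<lambda>N. \<i> * y * ((4 * x * y) ^ N / fact N)) sums (\<i> * y * exp (4 * x * y))"
    using exp_converges[of "4 * x * y"] by (intro sums_mult) (simp add: scaleR_conv_of_real field_simps)
  ultimately have "S = \<i> * y * exp (4 * x * y)"
    by (rule sums_unique2)
  with S show ?thesis by simp
qed

end
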